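(* Let $\lambda>0$, $\alpha>-2$, $p>0$, $p\ne3$, $(\alpha,p)\notin\mathscr{M}$, and let $\mathfrak{S}_0,\mathfrak{S}_1,\dots,\mathfrak{S}_{N_0}$ be the connected components of $\mathfrak{S}$, ordered as in the context. Assume that $u\in C^2(\mathbb{R}^2\setminus\{0\})$ is a global rupture solution of $$\Delta u=\frac{\lambda|x|^\alpha}{u^p}\ \text{ in }\mathbb{R}^2\setminus\{0\},\qquad u(0)=0,\quad u>0\ \text{ in }\mathbb{R}^2\setminus\{0\},$$ such that $0<C_1\le r^{-\frac{\alpha+2}{p+1}}u(r,\theta)\le C_2<\infty$ for all $(r,\theta)\in(0,\infty)\times S^1$ (polar coordinates; constants $C_1,C_2$ possibly depending on $u$), and such that $$w_0(\theta)=\lim_{r\to0^+}r^{-\frac{\alpha+2}{p+1}}u(r,\theta)\in\mathfrak{S}_m,\qquad w_\infty(\theta)=\lim_{r\to+\infty}r^{-\frac{\alpha+2}{p+1}}u(r,\theta)\in\mathfrak{S}_n$$ (limits in $C^2(S^1)$). Assume moreover that the following energy ordering holds: $$E(\mathfrak{S}_0)<E(\mathfrak{S}_1)<E(\mathfrak{S}_2)<\cdots<E(\mathfrak{S}_{N_0})\quad\text{if } 0<p<3,$$ $$E(\mathfrak{S}_1)<E(\mathfrak{S}_2)<\cdots<E(\mathfrak{S}_{N_0})<E(\mathfrak{S}_0)\quad\text{if } p>3.$$ Then: (1) for $1<p<3$, one has $0\le m\le n$; (2) for $p>3$, either $0<m\le n$, or $n=0$ and $0\le m\le N_0$.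
   Context: $S^1=\mathbb{R}/2\pi\mathbb{Z}$, $\beta=\frac{\alpha+2}{p+1}$, and $\mathfrak{S}$ is the set of all positive $w\in C^2(S^1)$ with $w''+\beta^2w-\lambda w^{-p}=0$. $\mathscr{M}=\mathscr{M}_1\cup\mathscr{M}_2\cup\mathscr{M}_3\cup\mathscr{M}_4$ with $$\mathscr{M}_1=\Big\{(\alpha,p):\alpha>-2,\ 0<p<1,\ \text{and either } \alpha\le-1 \text{ or there is an integer } j\ge1 \text{ with } \alpha\le j-1 \text{ and } p\le\big(\tfrac{\alpha+2}{j}\big)^2-1\Big\},$$ $$\mathscr{M}_2=\Big\{(\alpha,p):\alpha>-2,\ 1\le p<3,\ \text{and either } p\ge2\alpha+3 \text{ or there is an integer } j\ge1 \text{ with } \tfrac{2(\alpha+2)}{j+1}-1\le p\le\big(\tfrac{\alpha+2}{j}\big)^2-1\Big\},$$ $$\mathscr{M}_3=\{(\alpha,3):\alpha>-2,\ \alpha\notin\{0,2,4,\dots\}\},$$ $$\mathscr{M}_4=\Big\{(\alpha,p):\alpha>-2,\ p>3,\ \text{and either } p\ge(\alpha+2)^2-1 \text{ or there is an integer } j\ge1 \text{ with } \big(\tfrac{\alpha+2}{j+1}\big)^2-1\le p\le\tfrac{2(\alpha+2)}{j}-1\Big\}.$$ Let $J_{\alpha,p}$ be the open interval $\big(\frac{\alpha+2}{\sqrt{p+1}},\alpha+2\big)$ if $0<p<1$, $\big(\frac{\alpha+2}{\sqrt{p+1}},\frac{2(\alpha+2)}{p+1}\big)$ if $1\le p<3$,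 $\big(\frac{2(\alpha+2)}{p+1},\frac{\alpha+2}{\sqrt{p+1}}\big)$ if $p>3$; let $N_0$ be the number of integers in $J_{\alpha,p}$, $b_{\alpha,p}$ its left endpoint and $j_i=[b_{\alpha,p}]+i$ ($[\cdot]$ the integer part). For $(\alpha,p)\notin\mathscr{M}$, $p\neq3$, it is known that $1\le N_0<\infty$ and that $\mathfrak{S}$ has exactly $1+N_0$ connected components: $\mathfrak{S}_0=\{(\lambda/\beta^2)^{1/(p+1)}\}$ and $\mathfrak{S}_i=\{w_{j_i}(\cdot+a):0\le a<2\pi\}$, $i=1,\dots,N_0$, where $w_{j_i}\in\mathfrak{S}$ has minimal period $2\pi/j_i$. The energy is $$E(\psi)=\int_{S^1}\Big(\tfrac12(\psi')^2-\tfrac12\beta^2\psi^2-h(\psi)\Big)d\theta,\qquad h(x)=\begin{cases}\frac{\lambda}{(p-1)x^{p-1}},&p\ne1,\\-\lambda\ln x,&p=1.\end{cases}$$ $E$ is constant on each component $\mathfrak{S}_k$, and $E(\mathfrak{S}_k)$ denotes this constant value. *)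

theory Defs
  imports "HOL-Analysis.Analysis"
begin

section \<open>The space of twice continuously differentiable functions on the circle\<close>

text \<open>Functions on \<open>S\<^sup>1 = \<real>/2\<pi>\<int>\<close> are represented by \<open>2\<pi>\<close>-periodic functions on the real line.\<close>

definition C2_circle :: "(real \<Rightarrow> real) set" where
  "C2_circle = {w. (\<forall>\<theta>. w (\<theta> + 2 * pi) = w \<theta>)
     \<and> (\<forall>\<theta>. w field_differentiable (at \<theta>))
     \<and> (\<forall>\<theta>. deriv w field_differentiable (at \<theta>))
     \<and> continuous_on UNIV (deriv (deriv w))}"

definition C2_norm :: "(real \<Rightarrow> real) \<Rightarrow> real" where
  "C2_norm w = (SUP \<theta>. \<bar>w \<theta>\<bar>) + (SUP \<theta>. \<bar>deriv w \<theta>\<bar>) + (SUP \<theta>. \<bar>deriv (deriv w) \<theta>\<bar>)"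

text \<open>The value off \<^const>\<open>C2_circle\<close> is irrelevant; the library's locale for metric spaces
  requires nonnegativity and symmetry there as well.\<close>

definition C2_dist :: "(real \<Rightarrow> real) \<Rightarrow> (real \<Rightarrow> real) \<Rightarrow> real" where
  "C2_dist v w =
     (if v \<in> C2_circle \<and> w \<in> C2_circle then C2_norm (\<lambda>\<theta>. v \<theta> - w \<theta>) else 0)"

definition C2_topology :: "(real \<Rightarrow> real) topology" where
  "C2_topology = Metric_space.mtopology C2_circle C2_dist"

lemma periodic_continuous_bdd:
  fixes g :: "real \<Rightarrow> real"
  assumes per: "\<And>x. g (x + 2 * pi) = g x" and cont: "continuous_on UNIV g"
  shows "bdd_above (range (\<lambda>x. \<bar>g x\<bar>))"
proof -
  interpret periodic_fun_simple g "2 * pi"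
    by standard (rule per)
  have "compact ((\<lambda>x. \<bar>g x\<bar>) ` {0..2 * pi})"
    by (intro compact_continuous_image continuous_intros continuous_on_subset[OF cont]) auto
  then have bdd: "bdd_above ((\<lambda>x. \<bar>g x\<bar>) ` {0..2 * pi})"
    by (intro bounded_imp_bdd_above compact_imp_bounded)
  have "range (\<lambda>x. \<bar>g x\<bar>) \<subseteq> (\<lambda>x. \<bar>g x\<bar>) ` {0..2 * pi}"
  proof clarify
    fix x
    define k where "k = \<lfloor>x / (2 * pi)\<rfloor>"
    have "of_int k \<le> x / (2 * pi)" "x / (2 * pi) < of_int k + 1"
      unfolding k_def by linarith+
    then have "of_int k * (2 * pi) \<le> x" "x \<le> (of_int k + 1) * (2 * pi)"
      by (simp_all add: pos_le_divide_eq pos_divide_less_eq)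
    then have "x - of_int k * (2 * pi) \<in> {0..2 * pi}"
      by (auto simp: algebra_simps)
    moreover have "g (x - of_int k * (2 * pi)) = g x"
      by (rule minus_of_int)
    ultimately show "\<bar>g x\<bar> \<in> (\<lambda>x. \<bar>g x\<bar>) ` {0..2 * pi}"
      by (metis image_eqI)
  qed
  with bdd show ?thesis
    by (rule bdd_above_mono)
qed

lemma deriv_periodic:
  fixes g :: "real \<Rightarrow> real"
  assumes "\<And>x. g (x + c) = g x"
  shows "deriv g (x + c) = deriv g x"
proof -
  have "(g has_field_derivative D) (at (x + c)) \<longleftrightarrow> (g has_field_derivative D) (at x)" for D
    using assms by (simp add: DERIV_shift)
  then show ?thesis
    by (simp add: deriv_def)
qed

lemma C2_circle_diff:
  assumes "v \<in> C2_circle" "w \<in> C2_circle"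
  shows "(\<lambda>\<theta>. v \<theta> - w \<theta>) \<in> C2_circle"
    and "deriv (\<lambda>\<theta>. v \<theta> - w \<theta>) = (\<lambda>\<theta>. deriv v \<theta> - deriv w \<theta>)"
    and "deriv (deriv (\<lambda>\<theta>. v \<theta> - w \<theta>)) = (\<lambda>\<theta>. deriv (deriv v) \<theta> - deriv (deriv w) \<theta>)"
proof -
  show 1: "deriv (\<lambda>\<theta>. v \<theta> - w \<theta>) = (\<lambda>\<theta>. deriv v \<theta> - deriv w \<theta>)"
    using assms by (auto simp: C2_circle_def)
  show 2: "deriv (deriv (\<lambda>\<theta>. v \<theta> - w \<theta>)) = (\<lambda>\<theta>. deriv (deriv v) \<theta> - deriv (deriv w) \<theta>)"
    unfolding 1 using assms by (auto simp: C2_circle_def)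
  show "(\<lambda>\<theta>. v \<theta> - w \<theta>) \<in> C2_circle"
    unfolding C2_circle_def mem_Collect_eq 2 unfolding 1 using assms
    by (auto simp: C2_circle_def intro!: field_differentiable_diff continuous_intros)
qed

lemma C2_circle_bdd:
  assumes "w \<in> C2_circle"
  shows "bdd_above (range (\<lambda>\<theta>. \<bar>w \<theta>\<bar>))"
    and "bdd_above (range (\<lambda>\<theta>. \<bar>deriv w \<theta>\<bar>))"
    and "bdd_above (range (\<lambda>\<theta>. \<bar>deriv (deriv w) \<theta>\<bar>))"
proof -
  have per: "w (x + 2 * pi) = w x" for x
    using assms by (simp add: C2_circle_def)
  note per' = deriv_periodic[of w, OF per]
  have cont: "continuous_on UNIV w" "continuous_on UNIV (deriv w)"
    using assms
    by (auto simp: C2_circle_def continuous_on_eq_continuous_at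
             intro!: field_differentiable_imp_continuous_at)
  show "bdd_above (range (\<lambda>\<theta>. \<bar>w \<theta>\<bar>))"
    by (rule periodic_continuous_bdd[OF per cont(1)])
  show "bdd_above (range (\<lambda>\<theta>. \<bar>deriv w \<theta>\<bar>))"
    by (rule periodic_continuous_bdd[OF per' cont(2)])
  show "bdd_above (range (\<lambda>\<theta>. \<bar>deriv (deriv w) \<theta>\<bar>))"
    using assms
    by (intro periodic_continuous_bdd[where g = "deriv (deriv w)"] deriv_periodic[of "deriv w"] per')
       (simp add: C2_circle_def)
qed

lemma SUP_abs_nonneg:
  fixes g :: "real \<Rightarrow> real"
  assumes "bdd_above (range (\<lambda>x. \<bar>g x\<bar>))"
  shows "0 \<le> (SUP x. \<bar>g x\<bar>)"
  using cSUP_upper[OF UNIV_I assms, of 0] abs_ge_zero[of "g 0"] by linarith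

lemma SUP_abs_triangle:
  fixes f g h :: "real \<Rightarrow> real"
  assumes "bdd_above (range (\<lambda>x. \<bar>f x - g x\<bar>))" "bdd_above (range (\<lambda>x. \<bar>g x - h x\<bar>))"
  shows "(SUP x. \<bar>f x - h x\<bar>) \<le> (SUP x. \<bar>f x - g x\<bar>) + (SUP x. \<bar>g x - h x\<bar>)"
proof (rule cSUP_least)
  fix x
  show "\<bar>f x - h x\<bar> \<le> (SUP x. \<bar>f x - g x\<bar>) + (SUP x. \<bar>g x - h x\<bar>)"
    using cSUP_upper[OF UNIV_I assms(1), of x] cSUP_upper[OF UNIV_I assms(2), of x] by linarith
qed simp

lemma C2_dist_eq:
  assumes "v \<in> C2_circle" "w \<in> C2_circle"
  shows "C2_dist v w = (SUP \<theta>. \<bar>v \<theta> - w \<theta>\<bar>) + (SUP \<theta>. \<bar>deriv v \<theta> - deriv w \<theta>\<bar>)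
           + (SUP \<theta>. \<bar>deriv (deriv v) \<theta> - deriv (deriv w) \<theta>\<bar>)"
  using assms by (simp add: C2_dist_def C2_norm_def C2_circle_diff(3)) (simp add: C2_circle_diff(2))

lemma C2_dist_bdd:
  assumes "v \<in> C2_circle" "w \<in> C2_circle"
  shows "bdd_above (range (\<lambda>\<theta>. \<bar>v \<theta> - w \<theta>\<bar>))"
    and "bdd_above (range (\<lambda>\<theta>. \<bar>deriv v \<theta> - deriv w \<theta>\<bar>))"
    and "bdd_above (range (\<lambda>\<theta>. \<bar>deriv (deriv v) \<theta> - deriv (deriv w) \<theta>\<bar>))"
  using C2_circle_bdd[OF C2_circle_diff(1)[OF assms]]
  unfolding C2_circle_diff(3)[OF assms] unfolding C2_circle_diff(2)[OF assms] by simp_all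

text \<open>\<^const>\<open>C2_dist\<close> is a metric, so \<^const>\<open>C2_topology\<close> is the topology of uniform
  convergence of a function and its first two derivatives.\<close>

lemma C2_Metric_space: "Metric_space C2_circle C2_dist"
proof
  fix v w z :: "real \<Rightarrow> real"
  show nonneg: "0 \<le> C2_dist v w"
  proof (cases "v \<in> C2_circle \<and> w \<in> C2_circle")
    case True
    then show ?thesis
      by (simp add: C2_dist_eq C2_dist_bdd SUP_abs_nonneg add_nonneg_nonneg)
  next
    case False
    then show ?thesis by (auto simp: C2_dist_def)
  qed
  show "C2_dist v w = C2_dist w v"
  proof (cases "v \<in> C2_circle \<and> w \<in> C2_circle")
    case True
    then show ?thesis
      by (simp add: C2_dist_eq abs_minus_commute)
  next
    case False
    then show ?thesis by (auto simp: C2_dist_def)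
  qed
  assume v: "v \<in> C2_circle" and w: "w \<in> C2_circle"
  show "C2_dist v w = 0 \<longleftrightarrow> v = w"
  proof
    assume "C2_dist v w = 0"
    then have "(SUP \<theta>. \<bar>v \<theta> - w \<theta>\<bar>) = 0"
      using C2_dist_bdd[OF v w, THEN SUP_abs_nonneg] by (simp add: C2_dist_eq v w)
    then have "\<bar>v \<theta> - w \<theta>\<bar> \<le> 0" for \<theta>
      using cSUP_upper[OF UNIV_I C2_dist_bdd(1)[OF v w], of \<theta>] by simp
    then show "v = w"
      by (intro ext) simp
  qed (simp add: C2_dist_eq v w)
  assume z: "z \<in> C2_circle"
  show "C2_dist v z \<le> C2_dist v w + C2_dist w z"
    using SUP_abs_triangle[OF C2_dist_bdd(1)[OF v w] C2_dist_bdd(1)[OF w z]]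
      SUP_abs_triangle[OF C2_dist_bdd(2)[OF v w] C2_dist_bdd(2)[OF w z]]
      SUP_abs_triangle[OF C2_dist_bdd(3)[OF v w] C2_dist_bdd(3)[OF w z]]
    by (simp add: C2_dist_eq v w z)
qed


section \<open>The equation on the circle\<close>

definition beta :: "real \<Rightarrow> real \<Rightarrow> real" where
  "beta \<alpha> p = (\<alpha> + 2) / (p + 1)"

definition circle_solutions :: "real \<Rightarrow> real \<Rightarrow> real \<Rightarrow> (real \<Rightarrow> real) set" where
  "circle_solutions lam \<alpha> p = {w \<in> C2_circle. (\<forall>\<theta>. w \<theta> > 0)
     \<and> (\<forall>\<theta>. deriv (deriv w) \<theta> + (beta \<alpha> p)\<^sup>2 * w \<theta> - lam * w \<theta> powr (- p) = 0)}"

definition set_M1 :: "(real \<times> real) set" where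
  "set_M1 = {(\<alpha>, p). \<alpha> > -2 \<and> 0 < p \<and> p < 1 \<and>
     (\<alpha> \<le> -1 \<or> (\<exists>j::int. j \<ge> 1 \<and> \<alpha> \<le> j - 1 \<and> p \<le> ((\<alpha> + 2) / j)\<^sup>2 - 1))}"

definition set_M2 :: "(real \<times> real) set" where
  "set_M2 = {(\<alpha>, p). \<alpha> > -2 \<and> 1 \<le> p \<and> p < 3 \<and>
     (p \<ge> 2 * \<alpha> + 3 \<or>
      (\<exists>j::int. j \<ge> 1 \<and> 2 * (\<alpha> + 2) / (j + 1) - 1 \<le> p \<and> p \<le> ((\<alpha> + 2) / j)\<^sup>2 - 1))}"

definition set_M3 :: "(real \<times> real) set" where
  "set_M3 = {(\<alpha>, p). \<alpha> > -2 \<and> p = 3 \<and> \<not> (\<exists>k::nat. \<alpha> = 2 * k)}"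

definition set_M4 :: "(real \<times> real) set" where
  "set_M4 = {(\<alpha>, p). \<alpha> > -2 \<and> p > 3 \<and>
     (p \<ge> (\<alpha> + 2)\<^sup>2 - 1 \<or>
      (\<exists>j::int. j \<ge> 1 \<and> ((\<alpha> + 2) / (j + 1))\<^sup>2 - 1 \<le> p \<and> p \<le> 2 * (\<alpha> + 2) / j - 1))}"

definition set_M :: "(real \<times> real) set" where
  "set_M = set_M1 \<union> set_M2 \<union> set_M3 \<union> set_M4"

text \<open>The interval \<open>J\<close> is only used for \<open>p \<noteq> 3\<close>; the last branches below are meant for
  \<open>p > 3\<close>.\<close>

definition J_left :: "real \<Rightarrow> real \<Rightarrow> real" where
  "J_left \<alpha> p = (if p < 3 then (\<alpha> + 2) / sqrt (p + 1) else 2 * (\<alpha> + 2) / (p + 1))"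

definition J_right :: "real \<Rightarrow> real \<Rightarrow> real" where
  "J_right \<alpha> p = (if p < 1 then \<alpha> + 2
     else if p < 3 then 2 * (\<alpha> + 2) / (p + 1)
     else (\<alpha> + 2) / sqrt (p + 1))"

definition N0 :: "real \<Rightarrow> real \<Rightarrow> nat" where
  "N0 \<alpha> p = card {j::int. real_of_int j \<in> {J_left \<alpha> p<..<J_right \<alpha> p}}"

definition freq :: "real \<Rightarrow> real \<Rightarrow> nat \<Rightarrow> int" where
  "freq \<alpha> p i = \<lfloor>J_left \<alpha> p\<rfloor> + int i"

definition minimal_period :: "(real \<Rightarrow> real) \<Rightarrow> real \<Rightarrow> bool" where
  "minimal_period w T \<longleftrightarrow> T > 0 \<and> (\<forall>\<theta>. w (\<theta> + T) = w \<theta>)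
     \<and> (\<forall>T'. 0 < T' \<and> T' < T \<longrightarrow> \<not> (\<forall>\<theta>. w (\<theta> + T') = w \<theta>))"

text \<open>\<open>S 0, \<dots>, S (N0 \<alpha> p)\<close> lists the connected components of the solution set, without
  repetition and in the fixed order: first the constant solution, then the rotations of a solution
  of minimal period \<open>2\<pi>/j\<^sub>i\<close>. Values of \<open>S\<close> beyond \<open>N0 \<alpha> p\<close> are unconstrained.\<close>

definition ordered_components ::
  "real \<Rightarrow> real \<Rightarrow> real \<Rightarrow> (nat \<Rightarrow> (real \<Rightarrow> real) set) \<Rightarrow> bool" where
  "ordered_components lam \<alpha> p S \<longleftrightarrow>
     bij_betw S {0..N0 \<alpha> p}
       (connected_components_of (subtopology C2_topology (circle_solutions lam \<alpha> p)))
     \<and> S 0 = {\<lambda>\<theta>. (lam / (beta \<alpha> p)\<^sup>2) powr (1 / (p + 1))}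
     \<and> (\<forall>i\<in>{1..N0 \<alpha> p}. \<exists>w \<in> circle_solutions lam \<alpha> p.
          minimal_period w (2 * pi / freq \<alpha> p i)
          \<and> S i = {(\<lambda>\<theta>. w (\<theta> + a)) |a. 0 \<le> a \<and> a < 2 * pi})"

definition h_fun :: "real \<Rightarrow> real \<Rightarrow> real \<Rightarrow> real" where
  "h_fun lam p x = (if p = 1 then - lam * ln x else lam / ((p - 1) * x powr (p - 1)))"

definition energy :: "real \<Rightarrow> real \<Rightarrow> real \<Rightarrow> (real \<Rightarrow> real) \<Rightarrow> real" where
  "energy lam \<alpha> p \<psi> = integral {0..2 * pi}
     (\<lambda>\<theta>. (deriv \<psi> \<theta>)\<^sup>2 / 2 - (beta \<alpha> p)\<^sup>2 * (\<psi> \<theta>)\<^sup>2 / 2 - h_fun lam p (\<psi> \<theta>))"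

definition component_energy ::
  "real \<Rightarrow> real \<Rightarrow> real \<Rightarrow> (real \<Rightarrow> real) set \<Rightarrow> real" where
  "component_energy lam \<alpha> p C = (THE e. \<forall>w\<in>C. energy lam \<alpha> p w = e)"


section \<open>The equation in the punctured plane\<close>

text \<open>The plane is \<^typ>\<open>real \<times> real\<close>, whose norm is the Euclidean one and whose
  \<^const>\<open>Basis\<close> consists of the two standard unit vectors.\<close>

definition partial_deriv ::
  "'a::euclidean_space \<Rightarrow> ('a \<Rightarrow> real) \<Rightarrow> 'a \<Rightarrow> real" where
  "partial_deriv b f x = deriv (\<lambda>t. f (x + t *\<^sub>R b)) 0"

text \<open>On an open set, \<open>C\<^sup>k\<close> means that all partial derivatives of order at most \<open>k\<close> exist and are
  continuous.\<close>

definition C1_on :: "'a::euclidean_space set \<Rightarrow> ('a \<Rightarrow> real) \<Rightarrow> bool" where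
  "C1_on U f \<longleftrightarrow> continuous_on U f \<and>
     (\<forall>b\<in>Basis. (\<forall>x\<in>U. (\<lambda>t. f (x + t *\<^sub>R b)) field_differentiable (at 0))
        \<and> continuous_on U (partial_deriv b f))"

definition C2_on :: "'a::euclidean_space set \<Rightarrow> ('a \<Rightarrow> real) \<Rightarrow> bool" where
  "C2_on U f \<longleftrightarrow> C1_on U f \<and> (\<forall>b\<in>Basis. C1_on U (partial_deriv b f))"

definition laplacian :: "('a::euclidean_space \<Rightarrow> real) \<Rightarrow> 'a \<Rightarrow> real" where
  "laplacian f x = (\<Sum>b\<in>Basis. partial_deriv b (partial_deriv b f) x)"

definition global_rupture_solution ::
  "real \<Rightarrow> real \<Rightarrow> real \<Rightarrow> (real \<times> real \<Rightarrow> real) \<Rightarrow> bool" where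
  "global_rupture_solution lam \<alpha> p u \<longleftrightarrow>
     C2_on (- {0}) u \<and> u 0 = 0 \<and> (\<forall>x. x \<noteq> 0 \<longrightarrow> u x > 0)
     \<and> (\<forall>x. x \<noteq> 0 \<longrightarrow> laplacian u x = lam * norm x powr \<alpha> / u x powr p)"

definition rescaled ::
  "real \<Rightarrow> real \<Rightarrow> (real \<times> real \<Rightarrow> real) \<Rightarrow> real \<Rightarrow> real \<Rightarrow> real" where
  "rescaled \<alpha> p u r \<theta> = r powr (- ((\<alpha> + 2) / (p + 1))) * u (r * cos \<theta>, r * sin \<theta>)"

end

theory Submission
  imports Defs
begin

text \<open>In the variables \<open>t = ln r\<close> and \<open>\<theta>\<close>, and with \<open>b = (\<alpha> + 2) / (p + 1)\<close>, the rescaled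
  function \<open>v = r\<^sup>-\<^sup>b u\<close> solves the autonomous equation
  \<open>v\<^sub>t\<^sub>t + 2 b v\<^sub>t + v\<^sub>\<theta>\<^sub>\<theta> + b\<^sup>2 v = \<lambda> v\<^sup>-\<^sup>p\<close> on the cylinder \<open>\<real> \<times> S\<^sup>1\<close>. Let
  \<open>E\<close> be the energy on the circle. With \<open>t\<close> as time, the equation reads \<open>v\<^sub>t\<^sub>t + 2 b v\<^sub>t = E' (v)\<close>: it
  describes a motion in the potential \<open>- E\<close> with friction of positive coefficient \<open>2 b\<close>, and its
  stationary states are the solutions on the circle. Multiplying by \<open>v\<^sub>t\<close> and integrating over the
  circle gives
  \<open>d/dt (\<integral> v\<^sub>t\<^sup>2 / 2 d\<theta> - E (v)) = - 2 b \<integral> v\<^sub>t\<^sup>2 d\<theta> \<le> 0\<close>;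
  this is \<open>DERIV_lyapunov\<close> below.

  As \<open>t \<rightarrow> -\<infinity>\<close> the profile \<open>v\<close> converges to a stationary state together with two derivatives
  in \<open>\<theta>\<close>. So \<open>v\<^sub>t\<^sub>t + 2 b v\<^sub>t\<close> tends to \<open>0\<close> uniformly while \<open>v\<close> settles, which forces \<open>v\<^sub>t \<rightarrow> 0\<close>
  (\<open>velocity_vanishes\<close>), and the Lyapunov function starts from \<open>- E (w\<^sub>0)\<close>. At the other end the
  bound \<open>\<integral> v\<^sub>t\<^sup>2 \<ge> 0\<close> suffices: the Lyapunov function stays above \<open>- E (v)\<close>, which tends to
  \<open>- E (w\<^sub>\<infinity>)\<close>. Monotonicity therefore yields \<open>E (w\<^sub>0) \<le> E (w\<^sub>\<infinity>)\<close> (\<open>energy_limits_le\<close>).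

  The energy is constant on each component, so this inequality compares the energies of the
  components of index \<open>m\<close> and \<open>n\<close>, and the assumed ordering of the energies turns it into the
  asserted relation between the indices.\<close>

section \<open>Calculus of functions of two real variables\<close>

text \<open>Symmetry of the mixed partial derivatives, needed to recognise the flux term in
  \<open>DERIV_lyapunov\<close> as an exact \<open>\<theta>\<close>-derivative. Write \<open>f\<close> as the integral of \<open>fx\<close> along a
  horizontal segment and differentiate under the integral with respect to \<open>y\<close>; this exhibits \<open>fy\<close>
  as a primitive of \<open>fxy\<close>.\<close>

lemma mixed_partials_eq:
  fixes f fx fy fxy fyx :: "real \<Rightarrow> real \<Rightarrow> real"
  assumes fx: "\<And>x y. ((\<lambda>x. f x y) has_real_derivative fx x y) (at x)"
    and fy: "\<And>x y. (f x has_real_derivative fy x y) (at y)"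
    and fxy: "\<And>x y. (fx x has_real_derivative fxy x y) (at y)"
    and fyx: "\<And>x y. ((\<lambda>x. fy x y) has_real_derivative fyx x y) (at x)"
    and cont: "continuous_on UNIV (\<lambda>(x, y). fxy x y)"
  shows "fxy x0 y0 = fyx x0 y0"
proof -
  \<comment> \<open>A base point strictly to the left of \<open>x0\<close>, so that all integrals below have the correct
    orientation near \<open>x0\<close>.\<close>
  define c where "c = x0 - 1"
  have ftc: "((\<lambda>s. fx s y) has_integral f x y - f c y) {c..x}" if "c \<le> x" for x y
    using that
    by (intro fundamental_theorem_of_calculus)
       (auto simp flip: has_real_derivative_iff_has_vector_derivative
             intro: has_field_derivative_at_within fx)
  have slice: "continuous_on A (\<lambda>s. fxy s y)" for A y
    using continuous_on_compose2[OF cont, of A "\<lambda>s. (s, y)"]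
    by (simp add: continuous_on_Pair)
  have cont': "continuous_on (UNIV \<times> cbox c x) (\<lambda>(y, s). fxy s y)" for x
    using continuous_on_compose2[OF cont continuous_on_swap[of "UNIV \<times> cbox c x"]]
    by (auto simp: case_prod_beta)
  have eq: "fy x y = fy c y + integral {c..x} (\<lambda>s. fxy s y)" if "c \<le> x" for x y
  proof -
    have "((\<lambda>y. integral (cbox c x) (\<lambda>s. fx s y)) has_real_derivative
             integral (cbox c x) (\<lambda>s. fxy s y)) (at y)"
      using ftc[OF that] cont'
      by (intro leibniz_rule_field_derivative[where U = UNIV and f = "\<lambda>y s. fx s y"])
         (auto intro: fxy simp: has_integral_integrable)
    moreover have "(\<lambda>y. integral (cbox c x) (\<lambda>s. fx s y)) = (\<lambda>y. f x y - f c y)"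
      using ftc[OF that] by (auto intro!: ext integral_unique)
    ultimately have "((\<lambda>y. f x y - f c y) has_real_derivative integral {c..x} (\<lambda>s. fxy s y)) (at y)"
      by simp
    moreover have "((\<lambda>y. f x y - f c y) has_real_derivative fy x y - fy c y) (at y)"
      by (intro derivative_intros fy)
    ultimately show ?thesis
      using DERIV_unique by fastforce
  qed
  have x0: "x0 \<in> {c<..<c + 2}"
    by (simp add: c_def)
  have "((\<lambda>x. fy c y0 + integral {c..x} (\<lambda>s. fxy s y0)) has_real_derivative 0 + fxy x0 y0)
          (at x0 within {c..c + 2})"
    using x0 by (intro DERIV_add DERIV_const integral_has_real_derivative slice) auto
  then have "((\<lambda>x. fy c y0 + integral {c..x} (\<lambda>s. fxy s y0)) has_real_derivative fxy x0 y0) (at x0)"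
    using x0 at_within_Icc_at[of c x0 "c + 2"] by simp
  then have "((\<lambda>x. fy x y0) has_real_derivative fxy x0 y0) (at x0)"
  proof (rule has_field_derivative_transform_within_open)
    show "fy c y0 + integral {c..x} (\<lambda>s. fxy s y0) = fy x y0" if "x \<in> {c<..}" for x
      using that by (intro eq[symmetric]) simp
  qed (use x0 in simp_all)
  with fyx[where x = x0 and y = y0] show ?thesis
    using DERIV_unique by blast
qed

text \<open>Continuous partial derivatives give total differentiability: the passage from the coordinatewise
  notion \<^const>\<open>C1_on\<close> to the derivative that the chain rule needs.\<close>

lemma C1_on_has_derivative:
  fixes f :: "real \<times> real \<Rightarrow> real"
  assumes f: "C1_on U f" and U: "open U" and z: "z \<in> U"
  shows "(f has_derivative
            (\<lambda>(a, b). a * partial_deriv (1, 0) f z + b * partial_deriv (0, 1) f z)) (at z)"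
proof -
  obtain x y where zxy: "z = (x, y)" by (cases z)
  obtain X Y where XY: "open X" "open Y" "x \<in> X" "y \<in> Y" "X \<times> Y \<subseteq> U"
    using U z zxy by (auto simp: open_prod_def)
  obtain e where e: "e > 0" "ball y e \<subseteq> Y"
    using XY by (meson openE)
  \<comment> \<open>The criterion through partial derivatives asks for a convex set of second coordinates.\<close>
  define Y' where "Y' = ball y e"
  have Y': "open Y'" "convex Y'" "y \<in> Y'" "X \<times> Y' \<subseteq> U"
    using e XY by (auto simp: Y'_def)
  have basis: "(1, 0) \<in> (Basis :: (real \<times> real) set)" "(0, 1) \<in> (Basis :: (real \<times> real) set)"
    by (auto simp: Basis_prod_def)
  have D: "((\<lambda>t. f (q + t *\<^sub>R b)) has_real_derivative partial_deriv b f q) (at 0)"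
    if "q \<in> U" "b \<in> Basis" for q b
    using f that unfolding C1_on_def partial_deriv_def
    by (metis DERIV_deriv_iff_field_differentiable)
  have fx: "((\<lambda>x. f (x, y)) has_real_derivative partial_deriv (1, 0) f (x, y)) (at x)"
    if "(x, y) \<in> U" for x y
    using D[OF that basis(1)] DERIV_shift[of "\<lambda>x. f (x, y)" _ 0 x] by (simp add: add.commute)
  have fy: "((\<lambda>y. f (x, y)) has_real_derivative partial_deriv (0, 1) f (x, y)) (at y)"
    if "(x, y) \<in> U" for x y
    using D[OF that basis(2)] DERIV_shift[of "\<lambda>y. f (x, y)" _ 0 y] by (simp add: add.commute)
  have "continuous_on U (partial_deriv (0, 1) f)"
    using f basis by (auto simp: C1_on_def)
  then have "continuous (at (x, y)) (partial_deriv (0, 1) f)"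
    using U z zxy continuous_on_eq_continuous_at by blast
  then have "continuous (at (x, y) within X \<times> Y') (partial_deriv (0, 1) f)"
    by (rule continuous_at_imp_continuous_at_within)
  then have cont: "continuous (at (x, y) within X \<times> Y')
      (\<lambda>(x, y). blinfun_mult_left (partial_deriv (0, 1) f (x, y)))"
    unfolding case_prod_beta prod.collapse
    by (rule bounded_linear.continuous[OF bounded_linear_blinfun_mult_left])
  have "((\<lambda>(x, y). f (x, y)) has_derivative
      (\<lambda>(a, b). a * partial_deriv (1, 0) f (x, y)
         + blinfun_apply (blinfun_mult_left (partial_deriv (0, 1) f (x, y))) b))
      (at (x, y) within X \<times> Y')"
  proof (rule has_derivative_partialsI[OF _ _ cont])
    show "((\<lambda>x. f (x, y)) has_derivative (\<lambda>a. a * partial_deriv (1, 0) f (x, y))) (at x within X)"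
      by (rule has_derivative_eq_rhs[OF has_derivative_at_withinI[OF fx[unfolded has_field_derivative_def]]])
         (use z zxy in \<open>auto simp: mult.commute\<close>)
    show "((\<lambda>y. f (x, y)) has_derivative
        blinfun_apply (blinfun_mult_left (partial_deriv (0, 1) f (x, y)))) (at y within Y')"
      if "x \<in> X" "y \<in> Y'" for x y
      by (rule has_derivative_eq_rhs[OF has_derivative_at_withinI[OF fy[unfolded has_field_derivative_def]]])
         (use that Y' in \<open>auto simp: mult.commute\<close>)
  qed (use Y' in auto)
  moreover have "at (x, y) within X \<times> Y' = at (x, y)"
    using XY Y' by (intro at_within_open open_Times) auto
  ultimately show ?thesis
    by (simp add: zxy)
qed

section \<open>Logarithmic polar coordinates\<close>

definition log_polar :: "real \<Rightarrow> real \<Rightarrow> real \<times> real" where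
  "log_polar t \<theta> = (exp t * cos \<theta>, exp t * sin \<theta>)"

lemma norm_log_polar: "norm (log_polar t \<theta>) = exp t"
proof -
  have "(exp t * cos \<theta>)\<^sup>2 + (exp t * sin \<theta>)\<^sup>2 = (exp t)\<^sup>2 * ((sin \<theta>)\<^sup>2 + (cos \<theta>)\<^sup>2)"
    by (simp only: power_mult_distrib distrib_left add.commute)
  then show ?thesis
    by (simp add: log_polar_def norm_Pair)
qed

lemma log_polar_nonzero: "log_polar t \<theta> \<noteq> 0"
  using norm_log_polar[of t \<theta>] by (metis exp_not_eq_zero norm_zero)

lemma continuous_on_log_polar:
  assumes "continuous_on (- {0}) f"
  shows "continuous_on UNIV (\<lambda>(t, \<theta>). f (log_polar t \<theta>))"
proof -
  have "continuous_on UNIV (\<lambda>z. log_polar (fst z) (snd z))"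
    unfolding log_polar_def by (intro continuous_intros)
  then show ?thesis
    unfolding case_prod_beta
    by (rule continuous_on_compose2[OF assms]) (auto simp: log_polar_nonzero)
qed

lemma log_polar_chain_rule:
  fixes f :: "real \<times> real \<Rightarrow> real"
  assumes f: "C1_on (- {0}) f"
  defines "g1 \<equiv> \<lambda>t \<theta>. partial_deriv (1, 0) f (log_polar t \<theta>)"
    and "g2 \<equiv> \<lambda>t \<theta>. partial_deriv (0, 1) f (log_polar t \<theta>)"
  shows "((\<lambda>t. f (log_polar t \<theta>)) has_real_derivative
            exp t * (cos \<theta> * g1 t \<theta> + sin \<theta> * g2 t \<theta>)) (at t)" (is ?R)
    and "((\<lambda>\<theta>. f (log_polar t \<theta>)) has_real_derivative
            exp t * (cos \<theta> * g2 t \<theta> - sin \<theta> * g1 t \<theta>)) (at \<theta>)" (is ?A)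
proof -
  have D: "(f has_derivative (\<lambda>(a, b). a * g1 t \<theta> + b * g2 t \<theta>)) (at (log_polar t \<theta>))"
    unfolding g1_def g2_def
    by (rule C1_on_has_derivative[OF f]) (auto simp: log_polar_nonzero)
  have "((\<lambda>t. log_polar t \<theta>) has_derivative (\<lambda>h. (h * (exp t * cos \<theta>), h * (exp t * sin \<theta>)))) (at t)"
    unfolding log_polar_def by (auto intro!: derivative_eq_intros simp: algebra_simps)
  from has_derivative_compose[OF this D] show ?R
    unfolding has_field_derivative_def by (rule has_derivative_eq_rhs) (auto simp: algebra_simps)
  have "((\<lambda>\<theta>. log_polar t \<theta>) has_derivative (\<lambda>h. (- (h * (exp t * sin \<theta>)), h * (exp t * cos \<theta>)))) (at \<theta>)"
    unfolding log_polar_def by (auto intro!: derivative_eq_intros simp: algebra_simps)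
  from has_derivative_compose[OF this D] show ?A
    unfolding has_field_derivative_def by (rule has_derivative_eq_rhs) (auto simp: algebra_simps)
qed

section \<open>The energy on the circle\<close>

lemma integral_periodic_shift:
  fixes f :: "real \<Rightarrow> real"
  assumes per: "\<And>x. f (x + T) = f x" and cont: "continuous_on UNIV f" and a: "0 \<le> a" "a \<le> T"
  shows "integral {0..T} (\<lambda>x. f (x + a)) = integral {0..T} f"
proof -
  have int: "f integrable_on {c..d}" for c d
    by (intro integrable_continuous_interval continuous_on_subset[OF cont]) auto
  have "integral {0..T} (\<lambda>x. f (x + a)) = integral {a..T + a} f"
    using integral_shift_real_ivl[of a a "T + a" f] by simp
  also have "\<dots> = integral {a..T} f + integral {T..T + a} f"
    using a by (intro Henstock_Kurzweil_Integration.integral_combine[symmetric] int) auto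
  also have "integral {T..T + a} f = integral {0..a} f"
    using integral_shift_real_ivl[of T T "T + a" f] per by simp
  also have "integral {a..T} f + integral {0..a} f = integral {0..T} f"
    using a Henstock_Kurzweil_Integration.integral_combine[of 0 a T f] int by simp
  finally show ?thesis .
qed

lemma DERIV_h_fun:
  assumes "x > 0"
  shows "(h_fun lam p has_real_derivative - lam * x powr (- p)) (at x)"
proof (cases "p = 1")
  case True
  have "((\<lambda>x. - lam * ln x) has_real_derivative - lam * x powr (- p)) (at x)"
    using assms True by (auto intro!: derivative_eq_intros simp: powr_minus divide_simps)
  then show ?thesis
    using True by (simp add: h_fun_def[abs_def])
next
  case False
  have "((\<lambda>x. lam / (p - 1) * x powr (1 - p)) has_real_derivative - lam * x powr (- p)) (at x)"
  proof (rule DERIV_cong[OF DERIV_cmult[OF has_real_derivative_powr[OF assms]]])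
    show "lam / (p - 1) * ((1 - p) * x powr (1 - p - 1)) = - lam * x powr (- p)"
      using False by (simp add: field_simps)
  qed
  moreover have "lam / (p - 1) * x powr (1 - p) = h_fun lam p x" for x
    using False powr_minus_divide[of x "p - 1"] by (simp add: h_fun_def)
  ultimately show ?thesis
    by simp
qed

lemma continuous_on_h_fun: "continuous_on {0<..} (h_fun lam p)"
  by (auto intro!: continuous_at_imp_continuous_on DERIV_isCont[OF DERIV_h_fun])

text \<open>Each nonconstant component is a single orbit of rotations, so this invariance is what makes
  \<^const>\<open>component_energy\<close> well defined.\<close>

lemma energy_rotate:
  assumes w: "w \<in> C2_circle" and pos: "\<And>\<theta>. w \<theta> > 0" and a: "0 \<le> a" "a \<le> 2 * pi"
  shows "energy lam \<alpha> p (\<lambda>\<theta>. w (\<theta> + a)) = energy lam \<alpha> p w"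
proof -
  have per: "w (x + 2 * pi) = w x" for x
    using w by (simp add: C2_circle_def)
  have cont: "continuous_on UNIV w" "continuous_on UNIV (deriv w)"
    using w
    by (auto simp: C2_circle_def continuous_on_eq_continuous_at
             intro!: field_differentiable_imp_continuous_at)
  have "deriv (\<lambda>\<theta>. w (\<theta> + a)) \<theta> = deriv w (\<theta> + a)" for \<theta>
    by (simp add: deriv_def DERIV_shift)
  moreover have "integral {0..2 * pi} (\<lambda>\<theta>. (\<lambda>\<theta>. (deriv w \<theta>)\<^sup>2 / 2 - (beta \<alpha> p)\<^sup>2 * (w \<theta>)\<^sup>2 / 2
        - h_fun lam p (w \<theta>)) (\<theta> + a))
    = integral {0..2 * pi} (\<lambda>\<theta>. (deriv w \<theta>)\<^sup>2 / 2 - (beta \<alpha> p)\<^sup>2 * (w \<theta>)\<^sup>2 / 2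
        - h_fun lam p (w \<theta>))"
    using a pos
    by (intro integral_periodic_shift)
       (auto simp: per deriv_periodic[of w, OF per]
             intro!: continuous_intros cont continuous_on_compose2[OF continuous_on_h_fun cont(1)])
  ultimately show ?thesis
    by (simp add: energy_def)
qed

lemma limitin_C2_uniform_limits:
  assumes lim: "limitin C2_topology f w F"
  shows "uniform_limit UNIV f w F"
    and "uniform_limit UNIV (\<lambda>t. deriv (f t)) (deriv w) F"
    and "uniform_limit UNIV (\<lambda>t. deriv (deriv (f t))) (deriv (deriv w)) F"
proof -
  interpret Metric_space C2_circle C2_dist
    by (rule C2_Metric_space)
  have w: "w \<in> C2_circle"
    and ev: "\<And>e. e > 0 \<Longrightarrow> \<forall>\<^sub>F t in F. f t \<in> C2_circle \<and> C2_dist (f t) w < e"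
    using lim by (auto simp: C2_topology_def limitin_metric)
  have le: "\<bar>g \<theta> - w \<theta>\<bar> \<le> C2_dist g w \<and> \<bar>deriv g \<theta> - deriv w \<theta>\<bar> \<le> C2_dist g w
      \<and> \<bar>deriv (deriv g) \<theta> - deriv (deriv w) \<theta>\<bar> \<le> C2_dist g w" if g: "g \<in> C2_circle" for g \<theta>
    using C2_dist_bdd[OF g w, THEN SUP_abs_nonneg] C2_dist_bdd[OF g w, THEN cSUP_upper[OF UNIV_I], of \<theta>]
    unfolding C2_dist_eq[OF g w] by linarith
  show "uniform_limit UNIV f w F"
    and "uniform_limit UNIV (\<lambda>t. deriv (f t)) (deriv w) F"
    and "uniform_limit UNIV (\<lambda>t. deriv (deriv (f t))) (deriv (deriv w)) F"
    by (intro uniform_limitI, drule ev, erule eventually_mono,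
        use le in \<open>fastforce simp: dist_real_def intro: le_less_trans\<close>)+
qed

section \<open>Decay of the energy along the cylinder\<close>

text \<open>The mean value theorem provides a time \<open>s\<close> within one unit after \<open>t\<close> at which \<open>y'\<close> is at most
  \<open>2 \<delta>\<close>. The bound is carried back to \<open>t\<close> by the quantity \<open>y' + 2 b y\<close>, which moves by at most \<open>\<delta>\<close>
  in between because its derivative is \<open>y'' + 2 b y'\<close>.\<close>

lemma derivative_bound_damped:
  fixes y y' y'' :: "real \<Rightarrow> real"
  assumes y: "\<And>s. (y has_real_derivative y' s) (at s)"
    and y': "\<And>s. (y' has_real_derivative y'' s) (at s)"
    and b: "0 \<le> b"
    and near: "\<And>s. t \<le> s \<Longrightarrow> s \<le> t + 1 \<Longrightarrow> \<bar>y s - c\<bar> \<le> \<delta>"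
    and force: "\<And>s. t \<le> s \<Longrightarrow> s \<le> t + 1 \<Longrightarrow> \<bar>y'' s + 2 * b * y' s\<bar> \<le> \<delta>"
  shows "\<bar>y' t\<bar> \<le> (3 + 4 * b) * \<delta>"
proof -
  obtain s where s: "t < s" "s < t + 1" "y (t + 1) - y t = (t + 1 - t) * y' s"
    using MVT2[of t "t + 1" y y'] y by auto
  have "((\<lambda>s. y' s + 2 * b * y s) has_real_derivative y'' s + 2 * b * y' s) (at s)" for s
    by (auto intro!: derivative_eq_intros y y')
  then obtain r where r: "t < r" "r < s"
      "(y' s + 2 * b * y s) - (y' t + 2 * b * y t) = (s - t) * (y'' r + 2 * b * y' r)"
    using MVT2[OF s(1), of "\<lambda>s. y' s + 2 * b * y s" "\<lambda>s. y'' s + 2 * b * y' s"] by blast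
  have "\<bar>y' s\<bar> \<le> 2 * \<delta>"
    using s near[of t] near[of "t + 1"] by (auto simp: abs_le_iff)
  moreover have "\<bar>2 * b * (y s - y t)\<bar> \<le> 2 * b * (2 * \<delta>)"
    unfolding abs_mult using b s near[of t] near[of s]
    by (intro mult_mono) (auto simp: abs_le_iff)
  moreover have "\<bar>(s - t) * (y'' r + 2 * b * y' r)\<bar> \<le> 1 * \<delta>"
    unfolding abs_mult using s r force[of r] by (intro mult_mono) auto
  moreover have "y' t = y' s + 2 * b * (y s - y t) - (s - t) * (y'' r + 2 * b * y' r)"
    using r(3) by (simp add: algebra_simps)
  ultimately show ?thesis
    by (simp add: algebra_simps)
qed

text \<open>The names of the functions record partial derivatives of \<open>v\<close>, with \<open>t\<close> the logarithmic radius
  and \<open>x\<close> the angle. A single function \<open>vtx\<close> serves as both mixed derivatives.\<close>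

locale cylinder_solution =
  fixes lam \<alpha> p :: real and v vt vx vtt vtx vxx :: "real \<Rightarrow> real \<Rightarrow> real"
  assumes b_pos: "0 < beta \<alpha> p"
    and v_t: "\<And>t x. ((\<lambda>t. v t x) has_real_derivative vt t x) (at t)"
    and v_x: "\<And>t x. (v t has_real_derivative vx t x) (at x)"
    and vt_t: "\<And>t x. ((\<lambda>t. vt t x) has_real_derivative vtt t x) (at t)"
    and vt_x: "\<And>t x. (vt t has_real_derivative vtx t x) (at x)"
    and vx_t: "\<And>t x. ((\<lambda>t. vx t x) has_real_derivative vtx t x) (at t)"
    and vx_x: "\<And>t x. (vx t has_real_derivative vxx t x) (at x)"
    and cont: "continuous_on UNIV (\<lambda>(t, x). v t x)" "continuous_on UNIV (\<lambda>(t, x). vt t x)"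
      "continuous_on UNIV (\<lambda>(t, x). vx t x)" "continuous_on UNIV (\<lambda>(t, x). vtt t x)"
      "continuous_on UNIV (\<lambda>(t, x). vtx t x)"
    and periodic: "\<And>t x. v t (x + 2 * pi) = v t x"
    and pos: "\<And>t x. v t x > 0"
    and pde: "\<And>t x. vtt t x + 2 * beta \<alpha> p * vt t x + vxx t x + (beta \<alpha> p)\<^sup>2 * v t x = lam * v t x powr (- p)"
begin

abbreviation b :: real where
  "b \<equiv> beta \<alpha> p"

definition potential_density :: "real \<Rightarrow> real \<Rightarrow> real" where
  "potential_density t x = (vx t x)\<^sup>2 / 2 - b\<^sup>2 * (v t x)\<^sup>2 / 2 - h_fun lam p (v t x)"

definition lyapunov :: "real \<Rightarrow> real" where
  "lyapunov t = integral {0..2 * pi} (\<lambda>x. (vt t x)\<^sup>2 / 2 - potential_density t x)"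

lemma cont_compose [continuous_intros]:
  assumes "continuous_on A f" "continuous_on A g"
  shows "continuous_on A (\<lambda>z. v (f z) (g z))" "continuous_on A (\<lambda>z. vt (f z) (g z))"
    "continuous_on A (\<lambda>z. vx (f z) (g z))" "continuous_on A (\<lambda>z. vtt (f z) (g z))"
    "continuous_on A (\<lambda>z. vtx (f z) (g z))"
  using cont[THEN continuous_on_compose2, OF continuous_on_Pair[OF assms]] by auto

lemma continuous_potential_density: "continuous_on A (potential_density t)"
  unfolding potential_density_def
  by (intro continuous_intros continuous_on_compose2[OF continuous_on_h_fun]) (auto simp: pos)

lemma boundary_periodic: "vt t (2 * pi) = vt t 0" "vx t (2 * pi) = vx t 0"
proof -
  have "(\<lambda>t. v t (2 * pi)) = (\<lambda>t. v t 0)"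
    using periodic[of _ 0] by simp
  with v_t[of "2 * pi" t] v_t[of 0 t] show "vt t (2 * pi) = vt t 0"
    using DERIV_unique by metis
  show "vx t (2 * pi) = vx t 0"
    using deriv_periodic[of "v t" "2 * pi" 0, OF periodic] DERIV_imp_deriv[OF v_x] by simp
qed

text \<open>Differentiate under the integral and eliminate \<open>v\<^sub>t\<^sub>t\<close> through the equation. What remains
  besides the friction term is \<open>- (v\<^sub>t v\<^sub>\<theta>)\<^sub>\<theta>\<close>, whose integral over a period vanishes.\<close>

lemma DERIV_lyapunov:
  "(lyapunov has_real_derivative integral {0..2 * pi} (\<lambda>x. - 2 * b * (vt t x)\<^sup>2)) (at t)"
proof -
  define k where "k = (\<lambda>t x. vt t x * vtt t x - vx t x * vtx t x
      + b\<^sup>2 * v t x * vt t x - lam * v t x powr (- p) * vt t x)"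
  have D: "((\<lambda>t. (vt t x)\<^sup>2 / 2 - potential_density t x) has_real_derivative k t x) (at t)" for t x
    unfolding potential_density_def k_def
    by (rule derivative_eq_intros v_t vt_t vx_t DERIV_chain2[OF DERIV_h_fun v_t] pos refl
        | simp add: algebra_simps)+
  have "(lyapunov has_real_derivative integral (cbox 0 (2 * pi)) (k t)) (at t)"
    unfolding lyapunov_def[abs_def] box_real(2)[symmetric]
  proof (rule leibniz_rule_field_derivative[where U = UNIV])
    show "(\<lambda>x. (vt t x)\<^sup>2 / 2 - potential_density t x) integrable_on cbox 0 (2 * pi)" for t
      by (intro integrable_continuous continuous_intros continuous_potential_density) auto
    show "continuous_on (UNIV \<times> cbox 0 (2 * pi)) (\<lambda>(t, x). k t x)"
      unfolding k_def case_prod_beta by (intro continuous_intros) (auto simp: pos less_imp_neq[symmetric])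
  qed (use D in simp_all)
  moreover have "integral {0..2 * pi} (k t) = integral {0..2 * pi} (\<lambda>x. - 2 * b * (vt t x)\<^sup>2)"
  proof -
    have "((\<lambda>x. vt t x * vx t x) has_real_derivative vtx t x * vx t x + vt t x * vxx t x) (at x)" for x
      using DERIV_mult[OF vt_x vx_x] by (simp add: mult.commute add.commute)
    then have "((\<lambda>x. vtx t x * vx t x + vt t x * vxx t x) has_integral
             vt t (2 * pi) * vx t (2 * pi) - vt t 0 * vx t 0) {0..2 * pi}"
      by (intro fundamental_theorem_of_calculus)
         (auto simp flip: has_real_derivative_iff_has_vector_derivative
               intro: has_field_derivative_at_within)
    then have flux: "((\<lambda>x. vtx t x * vx t x + vt t x * vxx t x) has_integral 0) {0..2 * pi}"
      by (simp add: boundary_periodic)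
    have "(\<lambda>x. - 2 * b * (vt t x)\<^sup>2) integrable_on {0..2 * pi}"
      by (intro integrable_continuous_interval continuous_intros)
    then have "((\<lambda>x. - 2 * b * (vt t x)\<^sup>2 - (vtx t x * vx t x + vt t x * vxx t x)) has_integral
        integral {0..2 * pi} (\<lambda>x. - 2 * b * (vt t x)\<^sup>2) - 0) {0..2 * pi}"
      by (intro has_integral_diff flux integrable_integral)
    moreover have "- 2 * b * (vt t x)\<^sup>2 - (vtx t x * vx t x + vt t x * vxx t x) = k t x" for x
      unfolding k_def pde[symmetric] by (simp add: algebra_simps power2_eq_square)
    ultimately show ?thesis
      by (auto intro: integral_unique)
  qed
  ultimately show ?thesis
    by simp
qed

lemma lyapunov_antimono: "s \<le> t \<Longrightarrow> lyapunov t \<le> lyapunov s"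
proof (erule DERIV_nonpos_imp_nonincreasing)
  fix t
  have "integral {0..2 * pi} (\<lambda>x. - 2 * b * (vt t x)\<^sup>2) \<le> integral {0..2 * pi} (\<lambda>x. 0)"
    using b_pos
    by (intro integral_le integrable_continuous_interval continuous_intros) auto
  then show "\<exists>y. (lyapunov has_real_derivative y) (at t) \<and> y \<le> 0"
    using DERIV_lyapunov[of t] by (metis integral_0)
qed

lemma energy_eq: "energy lam \<alpha> p (v t) = integral {0..2 * pi} (potential_density t)"
proof -
  have "deriv (v t) = vx t"
    by (intro ext DERIV_imp_deriv v_x)
  then show ?thesis
    by (simp add: energy_def potential_density_def[abs_def])
qed

text \<open>The kinetic term is nonnegative. At the end \<open>t \<rightarrow> \<infinity>\<close> this one-sided bound takes the place of
  control over the velocity.\<close>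

lemma energy_ge: "- lyapunov t \<le> energy lam \<alpha> p (v t)"
proof -
  have "- lyapunov t = integral {0..2 * pi} (\<lambda>x. potential_density t x - (vt t x)\<^sup>2 / 2)"
    unfolding lyapunov_def by (simp flip: integral_neg)
  also have "\<dots> \<le> energy lam \<alpha> p (v t)"
    unfolding energy_eq
    by (intro integral_le integrable_continuous_interval continuous_intros
          continuous_potential_density) auto
  finally show ?thesis .
qed

text \<open>The two-sided bound keeps \<open>v\<close> in a compact subset of the positive half-line, where the singular
  nonlinearities \<open>v\<^sup>-\<^sup>p\<close> and \<^const>\<open>h_fun\<close> are uniformly continuous.\<close>

lemma uniform_limit_compose_v:
  assumes g: "continuous_on {0<..} (g :: real \<Rightarrow> real)"
    and range: "\<And>t x. v t x \<in> {C1..C2}" and C1: "0 < C1"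
    and lim: "uniform_limit UNIV v w F"
  shows "uniform_limit A (\<lambda>t x. g (v t x)) (\<lambda>x. g (w x)) F"
proof (rule uniform_limit_compose_uniformly_continuous_on[OF uniform_limit_on_subset[OF lim]])
  show "uniformly_continuous_on {C1..C2} g"
    using C1 by (intro compact_uniformly_continuous continuous_on_subset[OF g]) auto
qed (use range in auto)

text \<open>Stationarity of the limit makes \<open>vtt + 2 b vt\<close> tend to \<open>0\<close>, so that for each angle
  \<open>derivative_bound_damped\<close> applies, with constants independent of the angle.\<close>

lemma velocity_vanishes:
  assumes range: "\<And>t x. v t x \<in> {C1..C2}" and C1: "0 < C1"
    and lim: "uniform_limit UNIV v w at_bot" "uniform_limit UNIV vxx w'' at_bot"
    and stationary: "\<And>x. w'' x + b\<^sup>2 * w x = lam * w x powr (- p)"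
  shows "uniform_limit UNIV vt (\<lambda>x. 0) at_bot"
proof (rule uniform_limitI)
  fix e :: real
  assume e: "e > 0"
  \<comment> \<open>Chosen so that the bound of \<open>derivative_bound_damped\<close> is \<open>e / 2\<close>.\<close>
  define \<delta> where "\<delta> = e / (2 * (3 + 4 * b))"
  have \<delta>: "\<delta> > 0" "(3 + 4 * b) * \<delta> < e"
    using e b_pos by (simp_all add: \<delta>_def divide_simps)
  have "uniform_limit UNIV (\<lambda>t x. (lam * v t x powr (- p) - b\<^sup>2 * v t x) - vxx t x)
    (\<lambda>x. (lam * w x powr (- p) - b\<^sup>2 * w x) - w'' x) at_bot"
    by (intro uniform_limit_minus lim uniform_limit_compose_v[where w = w, OF _ range C1 lim(1)]
          continuous_intros) auto
  moreover have "(lam * v t x powr (- p) - b\<^sup>2 * v t x) - vxx t x = vtt t x + 2 * b * vt t x" for t x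
    using pde[of t x] by simp
  moreover have "(lam * w x powr (- p) - b\<^sup>2 * w x) - w'' x = 0" for x
    using stationary[of x] by simp
  ultimately have "uniform_limit UNIV (\<lambda>t x. vtt t x + 2 * b * vt t x) (\<lambda>x. 0) at_bot"
    by simp
  from uniform_limitD[OF this \<delta>(1)] uniform_limitD[OF lim(1) \<delta>(1)]
  have "\<forall>\<^sub>F t in at_bot. \<forall>x. \<bar>v t x - w x\<bar> \<le> \<delta> \<and> \<bar>vtt t x + 2 * b * vt t x\<bar> \<le> \<delta>"
    by eventually_elim (auto simp: dist_real_def less_imp_le)
  then obtain T where T: "\<bar>v t x - w x\<bar> \<le> \<delta>" "\<bar>vtt t x + 2 * b * vt t x\<bar> \<le> \<delta>" if "t \<le> T" for t x
    unfolding eventually_at_bot_linorder by blast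
  \<comment> \<open>One unit of room before \<open>T\<close>, since the bound at \<open>t\<close> uses the interval \<open>[t, t + 1]\<close>.\<close>
  have "\<bar>vt t x\<bar> < e" if "t \<le> T - 1" for t x
  proof -
    have "\<bar>vt t x\<bar> \<le> (3 + 4 * b) * \<delta>"
      by (rule derivative_bound_damped[OF v_t vt_t, where c = "w x"])
         (use b_pos T that in \<open>auto simp: less_imp_le\<close>)
    with \<delta> show ?thesis
      by simp
  qed
  then show "\<forall>\<^sub>F t in at_bot. \<forall>x\<in>UNIV. dist (vt t x) 0 < e"
    by (auto simp: eventually_at_bot_linorder)
qed

lemma uniform_limit_potential_density:
  assumes range: "\<And>t x. v t x \<in> {C1..C2}" and C1: "0 < C1"
    and lim: "uniform_limit UNIV v w F" "uniform_limit UNIV vx w' F" and bdd: "bounded (range w')"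
  shows "uniform_limit A potential_density
    (\<lambda>x. (w' x)\<^sup>2 / 2 - b\<^sup>2 * (w x)\<^sup>2 / 2 - h_fun lam p (w x)) F"
proof -
  have bdd': "bounded (w' ` A)"
    using bdd by (rule bounded_subset) auto
  have "uniform_limit A (\<lambda>t x. vx t x * vx t x) (\<lambda>x. w' x * w' x) F"
    using lim(2) bdd' by (intro uniform_lim_mult) (auto intro: uniform_limit_on_subset)
  then have "uniform_limit A (\<lambda>t x. (vx t x * vx t x) / 2) (\<lambda>x. (w' x * w' x) / 2) F"
    by (rule bounded_linear.uniform_limit[OF bounded_linear_divide])
  moreover have "uniform_limit A (\<lambda>t x. b\<^sup>2 * (v t x)\<^sup>2 / 2 + h_fun lam p (v t x))
      (\<lambda>x. b\<^sup>2 * (w x)\<^sup>2 / 2 + h_fun lam p (w x)) F"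
    by (intro uniform_limit_compose_v[OF _ range C1 lim(1)] continuous_intros continuous_on_h_fun) auto
  ultimately show ?thesis
    unfolding potential_density_def[abs_def] diff_diff_eq power2_eq_square[of "vx _ _"]
      power2_eq_square[of "w' _"]
    by (rule uniform_limit_minus)
qed

lemma C2_limits:
  assumes "limitin C2_topology v w F"
  shows "uniform_limit UNIV v w F" "uniform_limit UNIV vx (deriv w) F"
    "uniform_limit UNIV vxx (deriv (deriv w)) F" "bounded (range (deriv w))"
proof -
  have vx: "deriv (v t) = vx t" for t
    by (intro ext DERIV_imp_deriv v_x)
  have vxx: "deriv (vx t) = vxx t" for t
    by (intro ext DERIV_imp_deriv vx_x)
  show "uniform_limit UNIV v w F" "uniform_limit UNIV vx (deriv w) F"
    "uniform_limit UNIV vxx (deriv (deriv w)) F"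
    using limitin_C2_uniform_limits[OF assms] by (simp_all add: vx vxx)
  have "w \<in> C2_circle"
    using assms C2_Metric_space by (metis C2_topology_def Metric_space.limitin_metric)
  then show "bounded (range (deriv w))"
    using C2_circle_bdd(2)[of w] unfolding bounded_iff bdd_above_def by auto
qed

lemma energy_tendsto:
  assumes range: "\<And>t x. v t x \<in> {C1..C2}" and C1: "0 < C1"
    and lim: "limitin C2_topology v w F" and F: "F \<noteq> bot"
  shows "((\<lambda>t. energy lam \<alpha> p (v t)) \<longlongrightarrow> energy lam \<alpha> p w) F"
proof -
  note lims = C2_limits[OF lim]
  obtain I J where I: "\<And>t. (potential_density t has_integral I t) {0..2 * pi}"
    and J: "((\<lambda>x. (deriv w x)\<^sup>2 / 2 - b\<^sup>2 * (w x)\<^sup>2 / 2 - h_fun lam p (w x)) has_integral J) {0..2 * pi}"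
    and "(I \<longlongrightarrow> J) F"
    by (rule uniform_limit_integral[OF uniform_limit_potential_density[OF range C1 lims(1,2,4)] _ F])
       (auto intro: continuous_potential_density)
  moreover have "I = (\<lambda>t. energy lam \<alpha> p (v t))"
    using integral_unique[OF I] by (simp add: energy_eq)
  moreover have "J = energy lam \<alpha> p w"
    using integral_unique[OF J] by (simp add: energy_def)
  ultimately show ?thesis
    by simp
qed

lemma lyapunov_tendsto:
  assumes range: "\<And>t x. v t x \<in> {C1..C2}" and C1: "0 < C1"
    and lim: "limitin C2_topology v w at_bot" and w: "w \<in> circle_solutions lam \<alpha> p"
  shows "(lyapunov \<longlongrightarrow> - energy lam \<alpha> p w) at_bot"
proof -
  note lims = C2_limits[OF lim]
  have "deriv (deriv w) x + b\<^sup>2 * w x = lam * w x powr (- p)" for x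
    using w by (simp add: circle_solutions_def)
  then have vt: "uniform_limit {0..2 * pi} vt (\<lambda>x. 0) at_bot"
    using velocity_vanishes[OF range C1 lims(1,3)] by (auto intro: uniform_limit_on_subset)
  have "uniform_limit {0..2 * pi} (\<lambda>t x. (vt t x * vt t x) / 2) (\<lambda>x. (0 * 0) / 2) at_bot"
    by (intro bounded_linear.uniform_limit[OF bounded_linear_divide] uniform_lim_mult vt)
       (auto simp: image_constant_conv)
  then obtain I J where IJ: "\<And>t. ((\<lambda>x. (vt t x * vt t x) / 2) has_integral I t) {0..2 * pi}"
      "((\<lambda>x. (0 * 0) / 2 :: real) has_integral J) {0..2 * pi}" "(I \<longlongrightarrow> J) at_bot"
    by (rule uniform_limit_integral) (auto intro!: continuous_intros)
  have "J = 0"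
    using has_integral_unique[OF IJ(2)] by simp
  with IJ(3) have "((\<lambda>t. I t - energy lam \<alpha> p (v t)) \<longlongrightarrow> 0 - energy lam \<alpha> p w) at_bot"
    by (intro tendsto_diff energy_tendsto[OF range C1 lim]) auto
  moreover have "lyapunov = (\<lambda>t. I t - energy lam \<alpha> p (v t))"
  proof
    fix t
    have "(potential_density t has_integral energy lam \<alpha> p (v t)) {0..2 * pi}"
      unfolding energy_eq
      by (intro integrable_integral integrable_continuous_interval continuous_potential_density)
    from has_integral_diff[OF IJ(1) this] show "lyapunov t = I t - energy lam \<alpha> p (v t)"
      unfolding lyapunov_def power2_eq_square by (rule integral_unique)
  qed
  ultimately show ?thesis
    by simp
qed

text \<open>For \<open>s \<le> t\<close> one has \<open>- lyapunov s \<le> - lyapunov t \<le> E (v t)\<close>. Let \<open>t \<rightarrow> \<infinity>\<close> first, which bounds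
  \<open>- lyapunov\<close> by the energy of the outer limit at every time, and then \<open>s \<rightarrow> -\<infinity>\<close>.\<close>

lemma energy_limits_le:
  assumes range: "\<And>t x. v t x \<in> {C1..C2}" and C1: "0 < C1"
    and lim0: "limitin C2_topology v w0 at_bot" and w0: "w0 \<in> circle_solutions lam \<alpha> p"
    and liminf: "limitin C2_topology v winf at_top"
  shows "energy lam \<alpha> p w0 \<le> energy lam \<alpha> p winf"
proof -
  have "- lyapunov s \<le> energy lam \<alpha> p winf" for s
  proof (rule tendsto_lowerbound[OF energy_tendsto[OF range C1 liminf]])
    show "\<forall>\<^sub>F t in at_top. - lyapunov s \<le> energy lam \<alpha> p (v t)"
      using eventually_ge_at_top[of s]
    proof eventually_elim
      case (elim t)
      show ?case
        using lyapunov_antimono[OF elim] energy_ge[of t] by linarith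
    qed
  qed auto
  moreover have "((\<lambda>s. - lyapunov s) \<longlongrightarrow> - (- energy lam \<alpha> p w0)) at_bot"
    by (intro tendsto_minus lyapunov_tendsto[OF range C1 lim0 w0])
  ultimately show ?thesis
    using tendsto_upperbound[of "\<lambda>s. - lyapunov s" _ at_bot] by simp
qed

end

section \<open>From the punctured plane to the cylinder\<close>

text \<open>The exponent \<open>b\<close> is the one that makes the equation autonomous: by \<open>b (p + 1) = \<alpha> + 2\<close> the
  factors \<open>r\<^sup>-\<^sup>b\<close>, \<open>r\<^sup>2\<close> and \<open>r\<^sup>\<alpha>\<close> combine to the power of \<open>r\<close> that turns \<open>u\<^sup>-\<^sup>p\<close> into \<open>v\<^sup>-\<^sup>p\<close>.\<close>

lemma rupture_solution_on_cylinder: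
  assumes "\<alpha> > -2" "p > 0" and u: "global_rupture_solution lam \<alpha> p u"
  obtains vt vx vtt vtx vxx
  where "cylinder_solution lam \<alpha> p (\<lambda>t. rescaled \<alpha> p u (exp t)) vt vx vtt vtx vxx"
proof -
  define b where "b = beta \<alpha> p"
  have b: "b > 0" "b * (p + 1) = \<alpha> + 2"
    using assms by (auto simp: b_def beta_def)
  define u1 u2 where "u1 = partial_deriv (1, 0) u" and "u2 = partial_deriv (0, 1) u"
  define u11 u12 u21 u22 where "u11 = partial_deriv (1, 0) u1" and "u12 = partial_deriv (0, 1) u1"
    and "u21 = partial_deriv (1, 0) u2" and "u22 = partial_deriv (0, 1) u2"
  note u_defs = u1_def u2_def u11_def u12_def u21_def u22_def
  have basis: "(Basis :: (real \<times> real) set) = {(1, 0), (0, 1)}"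
    by (auto simp: Basis_prod_def)
  have C1: "C1_on (- {0}) u" "C1_on (- {0}) u1" "C1_on (- {0}) u2"
    using u unfolding global_rupture_solution_def C2_on_def u_defs by (auto simp: basis)
  have cont: "continuous_on (- {0}) u" "continuous_on (- {0}) u1" "continuous_on (- {0}) u2"
    "continuous_on (- {0}) u11" "continuous_on (- {0}) u12"
    "continuous_on (- {0}) u21" "continuous_on (- {0}) u22"
    using C1 unfolding C1_on_def u_defs by (auto simp: basis)
  have upos: "u (log_polar t x) > 0" for t x
    using u log_polar_nonzero unfolding global_rupture_solution_def by blast
  have lap: "u11 (log_polar t x) + u22 (log_polar t x) = lam * exp (\<alpha> * t) / u (log_polar t x) powr p"
    for t x
  proof -
    have "laplacian u (log_polar t x) = u11 (log_polar t x) + u22 (log_polar t x)"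
      by (simp add: laplacian_def basis u_defs)
    moreover have "laplacian u (log_polar t x) = lam * norm (log_polar t x) powr \<alpha> / u (log_polar t x) powr p"
      using u log_polar_nonzero unfolding global_rupture_solution_def by blast
    moreover have "exp t powr \<alpha> = exp (\<alpha> * t)"
      by (simp add: powr_def)
    ultimately show ?thesis
      by (simp add: norm_log_polar)
  qed
  note chain = log_polar_chain_rule[OF C1(1), folded u_defs] log_polar_chain_rule[OF C1(2), folded u_defs]
    log_polar_chain_rule[OF C1(3), folded u_defs]
  note cont_polar = cont[THEN continuous_on_log_polar, unfolded case_prod_beta]
  \<comment> \<open>Write \<open>U\<close> for \<open>u\<close> in logarithmic polar coordinates, so that \<open>v = e\<^sup>-\<^sup>b\<^sup>t U\<close>. \<open>Utx\<close> and \<open>Uxt\<close>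
    differentiate in \<open>t\<close> first and in \<open>x\<close> first, respectively; their formulas agree only once
    \<open>u12 = u21\<close> is known.\<close>
  define v where "v = (\<lambda>t x. exp (- b * t) * u (log_polar t x))"
  define Ut where "Ut = (\<lambda>t x. exp t * (cos x * u1 (log_polar t x) + sin x * u2 (log_polar t x)))"
  define Ux where "Ux = (\<lambda>t x. exp t * (cos x * u2 (log_polar t x) - sin x * u1 (log_polar t x)))"
  define vt where "vt = (\<lambda>t x. exp (- b * t) * (Ut t x - b * u (log_polar t x)))"
  define vx where "vx = (\<lambda>t x. exp (- b * t) * Ux t x)"
  define Utt where "Utt = (\<lambda>t x. Ut t x + (exp t)\<^sup>2 * ((cos x)\<^sup>2 * u11 (log_polar t x)
      + cos x * sin x * (u12 (log_polar t x) + u21 (log_polar t x)) + (sin x)\<^sup>2 * u22 (log_polar t x)))"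
  define Uxx where "Uxx = (\<lambda>t x. - Ut t x + (exp t)\<^sup>2 * ((sin x)\<^sup>2 * u11 (log_polar t x)
      - cos x * sin x * (u12 (log_polar t x) + u21 (log_polar t x)) + (cos x)\<^sup>2 * u22 (log_polar t x)))"
  define Utx where "Utx = (\<lambda>t x. Ux t x + (exp t)\<^sup>2 * (cos x * sin x * (u22 (log_polar t x) - u11 (log_polar t x))
      + (cos x)\<^sup>2 * u12 (log_polar t x) - (sin x)\<^sup>2 * u21 (log_polar t x)))"
  define Uxt where "Uxt = (\<lambda>t x. Ux t x + (exp t)\<^sup>2 * (cos x * sin x * (u22 (log_polar t x) - u11 (log_polar t x))
      + (cos x)\<^sup>2 * u21 (log_polar t x) - (sin x)\<^sup>2 * u12 (log_polar t x)))"
  have Ut_t: "((\<lambda>t. Ut t x) has_real_derivative Utt t x) (at t)" for t x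
    unfolding Ut_def Utt_def
    by (rule derivative_eq_intros chain refl)+
       (simp add: algebra_simps power2_eq_square)
  have Ut_x: "(Ut t has_real_derivative Utx t x) (at x)" for t x
    unfolding Ut_def Utx_def Ux_def
    by (rule derivative_eq_intros chain refl)+
       (simp add: algebra_simps power2_eq_square)
  have Ux_t: "((\<lambda>t. Ux t x) has_real_derivative Uxt t x) (at t)" for t x
    unfolding Ux_def Uxt_def
    by (rule derivative_eq_intros chain refl)+
       (simp add: algebra_simps power2_eq_square)
  have Ux_x: "(Ux t has_real_derivative Uxx t x) (at x)" for t x
    unfolding Ut_def Uxx_def Ux_def
    by (rule derivative_eq_intros chain refl)+
       (simp add: algebra_simps power2_eq_square)
  define vtt where "vtt = (\<lambda>t x. exp (- b * t) * (Utt t x - 2 * b * Ut t x + b\<^sup>2 * u (log_polar t x)))"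
  define vtx where "vtx = (\<lambda>t x. exp (- b * t) * (Utx t x - b * Ux t x))"
  define vxt where "vxt = (\<lambda>t x. exp (- b * t) * (Uxt t x - b * Ux t x))"
  define vxx where "vxx = (\<lambda>t x. exp (- b * t) * Uxx t x)"
  have v_t: "((\<lambda>t. v t x) has_real_derivative vt t x) (at t)" for t x
    unfolding v_def vt_def Ut_def
    by (rule derivative_eq_intros chain refl)+ (simp add: algebra_simps)
  have v_x: "(v t has_real_derivative vx t x) (at x)" for t x
    unfolding v_def vx_def Ux_def
    by (rule derivative_eq_intros chain refl)+ (simp add: algebra_simps)
  have vt_t: "((\<lambda>t. vt t x) has_real_derivative vtt t x) (at t)" for t x
    unfolding vt_def vtt_def
    by (rule derivative_eq_intros Ut_t chain(1)[folded Ut_def] refl)+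
       (simp add: Ut_def algebra_simps power2_eq_square)
  have vt_x: "(vt t has_real_derivative vtx t x) (at x)" for t x
    unfolding vt_def vtx_def
    by (rule derivative_eq_intros Ut_x chain refl)+ (simp add: Ux_def algebra_simps)
  have vx_t: "((\<lambda>t. vx t x) has_real_derivative vxt t x) (at t)" for t x
    unfolding vx_def vxt_def
    by (rule derivative_eq_intros Ux_t refl)+ (simp add: algebra_simps)
  have vx_x: "(vx t has_real_derivative vxx t x) (at x)" for t x
    unfolding vx_def vxx_def
    by (rule derivative_eq_intros Ux_x refl)+ (simp add: algebra_simps)
  have conts: "continuous_on UNIV (\<lambda>(t, x). v t x)" "continuous_on UNIV (\<lambda>(t, x). vt t x)"
      "continuous_on UNIV (\<lambda>(t, x). vx t x)" "continuous_on UNIV (\<lambda>(t, x). vtt t x)"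
      "continuous_on UNIV (\<lambda>(t, x). vtx t x)"
    unfolding v_def vt_def vx_def vtt_def vtx_def Utt_def Utx_def Ut_def Ux_def case_prod_beta
    by (intro continuous_intros cont_polar)+
  \<comment> \<open>Symmetry is invoked on the cylinder, where the domain is the whole plane, instead of in the
    punctured plane.\<close>
  have "vxt t x = vtx t x" for t x
    by (rule mixed_partials_eq[OF v_t v_x vt_x vx_t conts(5), symmetric])
  with vx_t have vx_t': "((\<lambda>t. vx t x) has_real_derivative vtx t x) (at t)" for t x
    by simp
  have pde: "vtt t x + 2 * b * vt t x + vxx t x + b\<^sup>2 * v t x = lam * v t x powr (- p)" for t x
  proof -
    define E U where "E = exp (- b * t)" and "U = u (log_polar t x)"
    have U: "U > 0"
      by (simp add: U_def upos)
    \<comment> \<open>The mixed derivatives of \<open>u\<close> and the first-order terms cancel, leaving \<open>r\<^sup>2 \<Delta>u\<close>.\<close>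
    have "Utt t x + Uxx t x
        = (exp t)\<^sup>2 * (((cos x)\<^sup>2 + (sin x)\<^sup>2) * (u11 (log_polar t x) + u22 (log_polar t x)))"
      unfolding Utt_def Uxx_def by algebra
    also have "\<dots> = (exp t)\<^sup>2 * (lam * exp (\<alpha> * t) / U powr p)"
      by (simp add: lap U_def)
    finally have sum: "Utt t x + Uxx t x = (exp t)\<^sup>2 * (lam * exp (\<alpha> * t) / U powr p)" .
    have "vtt t x + 2 * b * vt t x + vxx t x + b\<^sup>2 * v t x = E * (Utt t x + Uxx t x)"
      unfolding vtt_def vt_def vxx_def v_def E_def[symmetric] U_def[symmetric]
      by (simp add: algebra_simps power2_eq_square)
    also have "\<dots> = lam * (exp (- b * t + (2 * t + \<alpha> * t)) / U powr p)"
      unfolding sum E_def exp_add exp_double by simp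
    also have "- b * t + (2 * t + \<alpha> * t) = (b * p) * t"
      using b(2) by algebra
    also have "exp ((b * p) * t) / U powr p = E powr (- p) * U powr (- p)"
      by (simp add: powr_minus_divide[of U]) (simp add: E_def powr_def mult.commute mult.left_commute)
    also have "\<dots> = (E * U) powr (- p)"
      using U by (simp add: E_def powr_mult)
    finally show ?thesis
      by (simp add: v_def E_def U_def)
  qed
  have "cylinder_solution lam \<alpha> p v vt vx vtt vtx vxx"
  proof
    show "v t (x + 2 * pi) = v t x" for t x
      by (simp add: v_def log_polar_def)
    show "v t x > 0" for t x
      by (simp add: v_def upos)
  qed (fact b(1)[unfolded b_def] v_t v_x vt_t vt_x vx_t' vx_x conts pde[unfolded b_def])+
  moreover have "v = (\<lambda>t. rescaled \<alpha> p u (exp t))"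
    by (intro ext) (simp add: v_def rescaled_def log_polar_def powr_def b_def beta_def)
  ultimately show thesis
    using that by simp
qed

lemma limitin_compose_filterlim:
  assumes "limitin X f l F" "filterlim g F G"
  shows "limitin X (\<lambda>t. f (g t)) l G"
  unfolding limitin_def
proof (intro conjI allI impI)
  show "l \<in> topspace X"
    using assms(1) by (rule limitin_topspace)
  fix U
  assume "openin X U \<and> l \<in> U"
  then have "\<forall>\<^sub>F x in F. f x \<in> U"
    using limitinD[OF assms(1)] by blast
  then show "\<forall>\<^sub>F t in G. f (g t) \<in> U"
    using assms(2) by (rule eventually_compose_filterlim)
qed

lemma filterlim_exp_at_right_0: "filterlim exp (at_right (0 :: real)) at_bot"
  by (auto simp: filterlim_at exp_at_bot)

section \<open>Comparison of the components\<close>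

lemma ordered_components_member:
  assumes S: "ordered_components lam \<alpha> p S" and k: "k \<le> N0 \<alpha> p" and w: "w \<in> S k"
  shows "w \<in> circle_solutions lam \<alpha> p" "component_energy lam \<alpha> p (S k) = energy lam \<alpha> p w"
proof -
  have "S k \<in> connected_components_of (subtopology C2_topology (circle_solutions lam \<alpha> p))"
    using S k by (auto simp: ordered_components_def bij_betw_def)
  from connected_components_of_subset[OF this] w show "w \<in> circle_solutions lam \<alpha> p"
    by auto
  have "\<exists>e. \<forall>w\<in>S k. energy lam \<alpha> p w = e"
  proof (cases "k = 0")
    case True
    then show ?thesis
      using S by (auto simp: ordered_components_def)
  next
    case False
    with k have "k \<in> {1..N0 \<alpha> p}"
      by simp
    moreover have "\<forall>i\<in>{1..N0 \<alpha> p}. \<exists>w \<in> circle_solutions lam \<alpha> p.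
        minimal_period w (2 * pi / freq \<alpha> p i)
        \<and> S i = {(\<lambda>\<theta>. w (\<theta> + a)) |a. 0 \<le> a \<and> a < 2 * pi}"
      using S unfolding ordered_components_def by (elim conjE)
    ultimately obtain v where v: "v \<in> circle_solutions lam \<alpha> p"
      "S k = {(\<lambda>\<theta>. v (\<theta> + a)) |a. 0 \<le> a \<and> a < 2 * pi}"
      by (elim ballE[of _ _ k] bexE conjE) blast+
    have "energy lam \<alpha> p g = energy lam \<alpha> p v" if "g \<in> S k" for g
    proof -
      obtain a where "g = (\<lambda>\<theta>. v (\<theta> + a))" "0 \<le> a" "a < 2 * pi"
        using \<open>g \<in> S k\<close>[unfolded v(2)] unfolding mem_Collect_eq by (elim exE conjE)
      then show ?thesis
        using energy_rotate[of v a] v(1) by (simp add: circle_solutions_def)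
    qed
    then show ?thesis
      by blast
  qed
  with w show "component_energy lam \<alpha> p (S k) = energy lam \<alpha> p w"
    unfolding component_energy_def by (intro the_equality) auto
qed

lemma less_if_increasing_steps:
  fixes f :: "nat \<Rightarrow> 'a :: order"
  assumes "\<And>k. a \<le> k \<Longrightarrow> k < N \<Longrightarrow> f k < f (Suc k)" and "i < j" "a \<le> i" "j \<le> N"
  shows "f i < f j"
  using assms(2-4)
proof (induction rule: strict_inc_induct)
  case (step i)
  then show ?case
    using assms(1)[of i] by force
qed (use assms(1) in auto)

theorem theorem1p5:
  fixes lam \<alpha> p :: real
    and S :: "nat \<Rightarrow> (real \<Rightarrow> real) set"
    and u :: "real \<times> real \<Rightarrow> real"
    and w0 winf :: "real \<Rightarrow> real"
    and m n :: nat
  assumes "lam > 0" and "\<alpha> > -2" and "p > 0" and "p \<noteq> 3" and "(\<alpha>, p) \<notin> set_M"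
    and "ordered_components lam \<alpha> p S"
    and "global_rupture_solution lam \<alpha> p u"
    and "\<exists>C1 C2. 0 < C1 \<and> (\<forall>r>0. \<forall>\<theta>. C1 \<le> rescaled \<alpha> p u r \<theta> \<and> rescaled \<alpha> p u r \<theta> \<le> C2)"
    and "m \<le> N0 \<alpha> p" and "w0 \<in> S m"
    and "limitin C2_topology (rescaled \<alpha> p u) w0 (at_right 0)"
    and "n \<le> N0 \<alpha> p" and "winf \<in> S n"
    and "limitin C2_topology (rescaled \<alpha> p u) winf at_top"
    and "p < 3 \<Longrightarrow>
           \<forall>k<N0 \<alpha> p. component_energy lam \<alpha> p (S k) < component_energy lam \<alpha> p (S (Suc k))"
    and "p > 3 \<Longrightarrow>
           (\<forall>k. 1 \<le> k \<and> k < N0 \<alpha> p \<longrightarrow>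
              component_energy lam \<alpha> p (S k) < component_energy lam \<alpha> p (S (Suc k)))
           \<and> component_energy lam \<alpha> p (S (N0 \<alpha> p)) < component_energy lam \<alpha> p (S 0)"
  shows "(1 < p \<and> p < 3 \<longrightarrow> 0 \<le> m \<and> m \<le> n)
       \<and> (p > 3 \<longrightarrow> (0 < m \<and> m \<le> n) \<or> (n = 0 \<and> 0 \<le> m \<and> m \<le> N0 \<alpha> p))"
proof -
  obtain C1 C2 where C: "0 < C1"
    "\<And>r \<theta>. r > 0 \<Longrightarrow> C1 \<le> rescaled \<alpha> p u r \<theta> \<and> rescaled \<alpha> p u r \<theta> \<le> C2"
    using assms(8) by metis
  obtain vt vx vtt vtx vxx
    where "cylinder_solution lam \<alpha> p (\<lambda>t. rescaled \<alpha> p u (exp t)) vt vx vtt vtx vxx"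
    using rupture_solution_on_cylinder[OF assms(2,3,7)] .
  then interpret cylinder_solution lam \<alpha> p "\<lambda>t. rescaled \<alpha> p u (exp t)" vt vx vtt vtx vxx .
  have "energy lam \<alpha> p w0 \<le> energy lam \<alpha> p winf"
    using C ordered_components_member(1)[OF assms(6,9,10)]
    by (intro energy_limits_le[of C1 C2]
          limitin_compose_filterlim[OF assms(11) filterlim_exp_at_right_0]
          limitin_compose_filterlim[OF assms(14) exp_at_top]) auto
  then have le: "component_energy lam \<alpha> p (S m) \<le> component_energy lam \<alpha> p (S n)"
    using ordered_components_member(2)[OF assms(6)] assms(9,10,12,13) by simp
  show ?thesis
  proof (intro conjI impI)
    assume p: "1 < p \<and> p < 3"
    then have step: "\<forall>k<N0 \<alpha> p. component_energy lam \<alpha> p (S k) < component_energy lam \<alpha> p (S (Suc k))"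
      by (intro assms(15)) simp
    have "component_energy lam \<alpha> p (S n) < component_energy lam \<alpha> p (S m)" if "n < m"
      by (rule less_if_increasing_steps[where a = 0 and f = "\<lambda>k. component_energy lam \<alpha> p (S k)",
            OF _ that _ assms(9)]) (simp_all add: step)
    with le show "m \<le> n"
      by (meson leD leI)
  next
    assume p: "p > 3"
    have less: "component_energy lam \<alpha> p (S i) < component_energy lam \<alpha> p (S j)"
      if "1 \<le> i" "i < j" "j \<le> N0 \<alpha> p" for i j
      by (rule less_if_increasing_steps[where f = "\<lambda>k. component_energy lam \<alpha> p (S k)",
            OF _ that(2,1,3)]) (simp add: assms(16)[OF p])
    show "(0 < m \<and> m \<le> n) \<or> (n = 0 \<and> 0 \<le> m \<and> m \<le> N0 \<alpha> p)"
    proof (cases "n = 0")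
      case True
      then show ?thesis
        using assms(9) by simp
    next
      case False
      \<comment> \<open>The constant solution has the largest energy, so it cannot be the inner limit of a
        solution with a nonconstant outer limit.\<close>
      then have "component_energy lam \<alpha> p (S n) < component_energy lam \<alpha> p (S 0)"
        using less[of n "N0 \<alpha> p"] assms(16)[OF p] assms(12) by (cases "n = N0 \<alpha> p") auto
      with le have "m \<noteq> 0"
        by (metis leD)
      moreover have "m \<le> n"
        using less[of n m] le False assms(9) by (metis One_nat_def Suc_leI leD leI neq0_conv)
      ultimately show ?thesis
        by simp
    qed
  qed simp
qed

end
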